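(* Let $A,B\in\mathbb{C}[t]$ with $n=\deg(A)\ge 3$. If the Abel equation $x'=A(t)x^3+B(t)x^2$ has more than $(n+1)/2$ invariant curves, then it has a Darboux first integral.
   Context: An invariant curve of $x'=A(t)x^3+B(t)x^2$ (as counted in the hypothesis) means a curve $1+p(t)x=0$ with $p\in\mathbb{C}[t]$ non-constant, such that $f(t,x)=1+p(t)x$ satisfies $\mathcal{X}f=Kf$ for some $K\in\mathbb{C}[t,x]$, where $\mathcal{X}=\frac{\partial}{\partial t}+(A(t)x^3+B(t)x^2)\frac{\partial}{\partial x}$. Different polynomials $p$ give different invariant curves; the curve $x=0$ is not counted. More generally, for $f\in\mathbb{C}[t,x]$ non-constant, $f=0$ is an algebraic invariant curve if $\mathcal{X}f=Kf$ for some $K\in\mathbb{C}[t,x]$; for instance $x=0$ is always one. A first integral is a smooth enough function $f(t,x)$, not identically constant, with $\mathcal{X}f=0$. A Darboux first integral is a first integral of the form $f(t,x)=\prod_{i=1}^r f_i(t,x)^{\alpha_i}$ with $\alpha_i\in\mathbb{C}$ and each $f_i=0$ an algebraic invariant curve of the equation; complex powers are understood locally, on an open connected set where the $f_i$ do not vanish and branches of $\log f_i$ are chosen. *)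

theory Defs
  imports "HOL-Analysis.Analysis" "HOL-Computational_Algebra.Polynomial"
begin

text \<open>
  The ring \<open>\<complex>[t,x]\<close> is represented by the type \<open>complex poly poly\<close>: polynomials in \<open>x\<close> (outer
  variable) whose coefficients are polynomials in \<open>t\<close>. Both variables range over \<open>\<complex>\<close>.
\<close>

definition eval2 :: "complex poly poly \<Rightarrow> complex \<times> complex \<Rightarrow> complex" where
  "eval2 f = (\<lambda>(t, x). poly (poly f [:x:]) t)"

text \<open>
  The derivation \<open>\<partial>/\<partial>t + (A(t) x^3 + B(t) x^2) \<partial>/\<partial>x\<close> on \<open>\<complex>[t,x]\<close>; \<open>map_poly pderiv\<close> differentiates the
  coefficients, i.e. it is \<open>\<partial>/\<partial>t\<close>.
\<close>

definition abel_vf :: "complex poly \<Rightarrow> complex poly \<Rightarrow> complex poly poly \<Rightarrow> complex poly poly" where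
  "abel_vf A B f = map_poly pderiv f + [:0, 0, B, A:] * pderiv f"

definition algebraic_invariant_curve ::
  "complex poly \<Rightarrow> complex poly \<Rightarrow> complex poly poly \<Rightarrow> bool" where
  "algebraic_invariant_curve A B f \<longleftrightarrow>
     (\<nexists>c. f = [:[:c:]:]) \<and> (\<exists>K. abel_vf A B f = K * f)"

text \<open>
  The curves \<open>1 + p(t) x = 0\<close> with \<open>p\<close> non-constant, identified with the polynomials \<open>p\<close>.
\<close>

definition abel_invariant_curves :: "complex poly \<Rightarrow> complex poly \<Rightarrow> complex poly set" where
  "abel_invariant_curves A B =
     {p. degree p > 0 \<and> (\<exists>K. abel_vf A B [:1, p:] = K * [:1, p:])}"

text \<open>
  ``Smooth enough'' is read as complex differentiable, jointly in \<open>(t,x)\<close>, at every point of the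
  open set \<open>U\<close>; \<open>a\<close> and \<open>b\<close> are the partial derivatives with respect to \<open>t\<close> and \<open>x\<close>.
\<close>

definition first_integral_on ::
  "complex poly \<Rightarrow> complex poly \<Rightarrow> (complex \<times> complex) set \<Rightarrow> (complex \<times> complex \<Rightarrow> complex) \<Rightarrow> bool"
where
  "first_integral_on A B U F \<longleftrightarrow>
     \<not> F constant_on U \<and>
     (\<forall>(t, x) \<in> U. \<exists>a b. (F has_derivative (\<lambda>(h, k). a * h + b * k)) (at (t, x)) \<and>
        a + (poly A t * x ^ 3 + poly B t * x ^ 2) * b = 0)"

text \<open>
  \<open>L i\<close> is a branch of \<open>log (f i)\<close> on \<open>U\<close> (so \<open>f i\<close> has no zero in \<open>U\<close>), and \<open>f i\<close> to the power
  \<open>\<alpha> i\<close> is \<open>exp (\<alpha> i * L i)\<close>.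
\<close>

definition darboux_first_integral_on ::
  "complex poly \<Rightarrow> complex poly \<Rightarrow> (complex \<times> complex) set \<Rightarrow> (complex \<times> complex \<Rightarrow> complex) \<Rightarrow> bool"
where
  "darboux_first_integral_on A B U F \<longleftrightarrow>
     first_integral_on A B U F \<and>
     (\<exists>(r::nat) (f :: nat \<Rightarrow> complex poly poly) (\<alpha> :: nat \<Rightarrow> complex)
        (L :: nat \<Rightarrow> complex \<times> complex \<Rightarrow> complex).
        (\<forall>i<r. algebraic_invariant_curve A B (f i) \<and> continuous_on U (L i) \<and>
               (\<forall>z\<in>U. exp (L i z) = eval2 (f i) z)) \<and>
        (\<forall>z\<in>U. F z = (\<Prod>i<r. exp (\<alpha> i * L i z))))"

definition has_darboux_first_integral :: "complex poly \<Rightarrow> complex poly \<Rightarrow> bool" where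
  "has_darboux_first_integral A B \<longleftrightarrow>
     (\<exists>U F. open U \<and> connected U \<and> U \<noteq> {} \<and> darboux_first_integral_on A B U F)"

end

theory Submission
  imports Defs
begin

text \<open>
  The curve \<open>1 + p x = 0\<close> is invariant iff \<open>p (B - p') = A\<close>, and its cofactor is then
  \<open>p' x + A x\<^sup>2\<close>, while \<open>x = 0\<close> has cofactor \<open>B x + A x\<^sup>2\<close>. Hence every linear relation
  \<open>\<Sum> \<alpha>\<^sub>p (B - p') = 0\<close> yields the Darboux first integral \<open>x\<^bsup>-\<Sum> \<alpha>\<^sub>p\<^esup> \<Prod> (1 + p x)\<^bsup>\<alpha>\<^sub>p\<^esup>\<close>.
  Two distinct curves satisfy \<open>p r (p - r)' = A (p - r)\<close>, which forces
  \<open>deg p + deg r = n + 1\<close>. With at least three curves, all \<open>p\<close> have degree \<open>m = (n + 1)/2\<close>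
  and all \<open>B - p' = A / p\<close> have degree \<open>m - 1\<close>, so any \<open>m + 1\<close> of them are linearly dependent.
\<close>

section \<open>Evaluation and partial derivatives of polynomials in \<open>t\<close> and
  \<open>x\<close>\<close>

lemma eval2_simps [simp]:
  "eval2 0 z = 0" "eval2 (f + g) z = eval2 f z + eval2 g z" "eval2 (f * g) z = eval2 f z * eval2 g z"
  "eval2 (smult c f) z = poly c (fst z) * eval2 f z"
  "eval2 (pCons c f) z = poly c (fst z) + snd z * eval2 f z"
  by (simp_all add: eval2_def split: prod.split)

lemma eval2_sum: "eval2 (\<Sum>i\<in>I. f i) z = (\<Sum>i\<in>I. eval2 (f i) z)"
  by (induction I rule: infinite_finite_induct) simp_all

lemma eval2_abel_vf:
  "eval2 (abel_vf A B f) (t, x) =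
     eval2 (map_poly pderiv f) (t, x) + (poly A t * x ^ 3 + poly B t * x ^ 2) * eval2 (pderiv f) (t, x)"
  by (simp add: abel_vf_def algebra_simps power2_eq_square power3_eq_cube)

text \<open>Evaluating \<open>pCons c f\<close> gives \<open>c(t) + x * f(t, x)\<close>, so the
  product rule drives an induction on \<open>f\<close>. The formal derivations thereby become
  analytic partial derivatives, which links \<open>abel_vf\<close> to
  \<open>first_integral_on\<close>.\<close>

lemma has_derivative_eval2:
  "(eval2 f has_derivative
     (\<lambda>(h, k). eval2 (map_poly pderiv f) z * h + eval2 (pderiv f) z * k)) (at z)"
proof (induction f)
  case 0
  then show ?case by (simp add: eval2_simps(1)[abs_def] case_prod_unfold)
next
  case (pCons c f)
  have "((\<lambda>w. poly c (fst w)) has_derivative (\<lambda>v. poly (pderiv c) (fst z) * fst v)) (at z)"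
    using has_derivative_compose[OF has_derivative_fst[OF has_derivative_ident]
        poly_DERIV[unfolded has_field_derivative_def], of c z UNIV] by simp
  moreover have "((\<lambda>w. snd w * eval2 f w) has_derivative
      (\<lambda>v. snd z * (eval2 (map_poly pderiv f) z * fst v + eval2 (pderiv f) z * snd v)
           + snd v * eval2 f z)) (at z)"
    by (rule has_derivative_mult[OF has_derivative_snd[OF has_derivative_ident]
          pCons.IH[unfolded case_prod_unfold]])
  ultimately have "((\<lambda>w. poly c (fst w) + snd w * eval2 f w) has_derivative
      (\<lambda>v. poly (pderiv c) (fst z) * fst v +
        (snd z * (eval2 (map_poly pderiv f) z * fst v + eval2 (pderiv f) z * snd v)
           + snd v * eval2 f z))) (at z)"
    by (rule has_derivative_add)
  moreover have "eval2 (pCons c f) = (\<lambda>w. poly c (fst w) + snd w * eval2 f w)"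
    by (rule ext) simp
  ultimately show ?case
    by (simp add: map_poly_pCons pderiv_pCons case_prod_unfold algebra_simps)
qed

section \<open>Darboux functions from cofactors\<close>

text \<open>The quotient of \<open>f i\<close> by its value at \<open>z\<^sub>0\<close> is 1 there,
  so on a small ball all these quotients stay in the right half-plane, where the principal
  \<open>Ln\<close> is holomorphic. Adding a constant turns their logarithms into logarithms of the
  \<open>f i\<close>.\<close>

lemma local_log_branches:
  fixes I :: "'i set" and f :: "'i \<Rightarrow> complex poly poly"
  assumes I: "finite I" and nz: "\<And>i. i \<in> I \<Longrightarrow> eval2 (f i) z\<^sub>0 \<noteq> 0"
  obtains U L where "open U" "connected U" "z\<^sub>0 \<in> U"
    "\<And>i z. i \<in> I \<Longrightarrow> z \<in> U \<Longrightarrow> exp (L i z) = eval2 (f i) z"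
    "\<And>i z. i \<in> I \<Longrightarrow> z \<in> U \<Longrightarrow> (L i has_derivative
       (\<lambda>(h, k). eval2 (map_poly pderiv (f i)) z / eval2 (f i) z * h
                 + eval2 (pderiv (f i)) z / eval2 (f i) z * k)) (at z)"
proof -
  define Q where "Q i z = eval2 (f i) z / eval2 (f i) z\<^sub>0" for i z
  define L where "L i z = Ln (Q i z) + Ln (eval2 (f i) z\<^sub>0)" for i z
  have contQ: "continuous_on UNIV (\<lambda>z. Re (Q i z))" if "i \<in> I" for i
    unfolding Q_def using has_derivative_eval2 nz[OF that]
    by (intro continuous_intros) (auto simp: continuous_on_eq_continuous_at intro: has_derivative_continuous)
  have "open (\<Inter>i\<in>I. {z. 0 < Re (Q i z)})"
    using I contQ by (intro open_INT ballI open_Collect_less continuous_on_const)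
  moreover have "z\<^sub>0 \<in> (\<Inter>i\<in>I. {z. 0 < Re (Q i z)})"
    using nz by (simp add: Q_def)
  ultimately obtain e where e: "e > 0" "ball z\<^sub>0 e \<subseteq> (\<Inter>i\<in>I. {z. 0 < Re (Q i z)})"
    by (meson open_contains_ball)
  show thesis
  proof (rule that[of "ball z\<^sub>0 e" L])
    fix i z assume iz: "i \<in> I" "z \<in> ball z\<^sub>0 e"
    then have pos: "0 < Re (Q i z)" using e by auto
    then have "Q i z \<noteq> 0" by auto
    then show "exp (L i z) = eval2 (f i) z"
      using nz[OF iz(1)] by (simp add: L_def exp_add Q_def)
    have nzz: "eval2 (f i) z \<noteq> 0" using \<open>Q i z \<noteq> 0\<close> by (auto simp: Q_def)
    have "Q i z \<notin> \<real>\<^sub>\<le>\<^sub>0" using pos complex_nonpos_Reals_iff by auto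
    then have "(Ln has_derivative (\<lambda>h. inverse (Q i z) * h)) (at (Q i z))"
      using has_field_derivative_Ln[OF \<open>Q i z \<notin> \<real>\<^sub>\<le>\<^sub>0\<close>] by (simp add: has_field_derivative_def)
    moreover have "((\<lambda>w. Q i w) has_derivative (\<lambda>v. (case v of (h, k) \<Rightarrow>
        eval2 (map_poly pderiv (f i)) z * h + eval2 (pderiv (f i)) z * k) / eval2 (f i) z\<^sub>0)) (at z)"
      unfolding Q_def divide_inverse
      by (rule has_derivative_mult_left[OF has_derivative_eval2])
    ultimately have "((\<lambda>w. Ln (Q i w) + Ln (eval2 (f i) z\<^sub>0)) has_derivative
       (\<lambda>v. inverse (Q i z) * ((case v of (h, k) \<Rightarrow>
        eval2 (map_poly pderiv (f i)) z * h + eval2 (pderiv (f i)) z * k) / eval2 (f i) z\<^sub>0))) (at z)"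
      by (intro has_derivative_add_const) (rule has_derivative_compose[of _ _ z UNIV])
    moreover have "(\<lambda>v. inverse (Q i z) * ((case v of (h, k) \<Rightarrow>
        eval2 (map_poly pderiv (f i)) z * h + eval2 (pderiv (f i)) z * k) / eval2 (f i) z\<^sub>0)) =
       (\<lambda>(h, k). eval2 (map_poly pderiv (f i)) z / eval2 (f i) z * h
                 + eval2 (pderiv (f i)) z / eval2 (f i) z * k)"
      using nz[OF iz(1)] nzz by (auto simp: fun_eq_iff Q_def field_simps)
    ultimately show "(L i has_derivative
       (\<lambda>(h, k). eval2 (map_poly pderiv (f i)) z / eval2 (f i) z * h
                 + eval2 (pderiv (f i)) z / eval2 (f i) z * k)) (at z)"
      by (simp only: L_def[abs_def])
  qed (use e in auto)
qed

text \<open>The derivative of \<open>\<Sum> \<alpha> i * L i\<close> along the vector field is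
  \<open>\<Sum> \<alpha> i * K i\<close>, hence 0, and \<open>F\<close> is the exponential of this
  sum. The hypothesis \<open>deriv_nz\<close> gives \<open>log F\<close> a non-zero
  \<open>t\<close>-derivative at \<open>z\<^sub>0\<close>, which excludes constancy.\<close>

lemma has_darboux_first_integralI:
  fixes I :: "'i set" and f K :: "'i \<Rightarrow> complex poly poly"
  assumes I: "finite I"
    and nonconst: "\<And>i. i \<in> I \<Longrightarrow> \<nexists>c. f i = [:[:c:]:]"
    and cofactor: "\<And>i. i \<in> I \<Longrightarrow> abel_vf A B (f i) = K i * f i"
    and sum0: "(\<Sum>i\<in>I. smult [:\<alpha> i:] (K i)) = 0"
    and nz: "\<And>i. i \<in> I \<Longrightarrow> eval2 (f i) z\<^sub>0 \<noteq> 0"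
    and deriv_nz: "(\<Sum>i\<in>I. \<alpha> i * (eval2 (map_poly pderiv (f i)) z\<^sub>0 / eval2 (f i) z\<^sub>0)) \<noteq> 0"
  shows "has_darboux_first_integral A B"
proof -
  obtain U L where U: "open U" "connected U" "z\<^sub>0 \<in> U"
    and expL: "\<And>i z. i \<in> I \<Longrightarrow> z \<in> U \<Longrightarrow> exp (L i z) = eval2 (f i) z"
    and L': "\<And>i z. i \<in> I \<Longrightarrow> z \<in> U \<Longrightarrow> (L i has_derivative
       (\<lambda>(h, k). eval2 (map_poly pderiv (f i)) z / eval2 (f i) z * h
                 + eval2 (pderiv (f i)) z / eval2 (f i) z * k)) (at z)"
    using local_log_branches[of I f z\<^sub>0] I nz by blast
  define F where "F z = (\<Prod>i\<in>I. exp (\<alpha> i * L i z))" for z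
  define a where "a z = (\<Sum>i\<in>I. \<alpha> i * (eval2 (map_poly pderiv (f i)) z / eval2 (f i) z))" for z
  define b where "b z = (\<Sum>i\<in>I. \<alpha> i * (eval2 (pderiv (f i)) z / eval2 (f i) z))" for z
  have F_exp: "F = (\<lambda>z. exp (\<Sum>i\<in>I. \<alpha> i * L i z))"
    by (simp add: F_def[abs_def] exp_sum I)
  have F': "(F has_derivative (\<lambda>(h, k). F z * a z * h + F z * b z * k)) (at z)" if "z \<in> U" for z
  proof -
    have "((\<lambda>z. \<Sum>i\<in>I. \<alpha> i * L i z) has_derivative
       (\<lambda>v. \<Sum>i\<in>I. \<alpha> i * (case v of (h, k) \<Rightarrow> eval2 (map_poly pderiv (f i)) z / eval2 (f i) z * h
                 + eval2 (pderiv (f i)) z / eval2 (f i) z * k))) (at z)"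
      by (intro has_derivative_sum has_derivative_mult_right L' that)
    moreover have "(exp has_derivative (\<lambda>v. F z * v)) (at (\<Sum>i\<in>I. \<alpha> i * L i z))"
      using DERIV_exp[of "\<Sum>i\<in>I. \<alpha> i * L i z"]
      by (simp add: has_field_derivative_def F_exp)
    ultimately have "(F has_derivative (\<lambda>v. F z * (\<Sum>i\<in>I. \<alpha> i * (case v of (h, k) \<Rightarrow>
        eval2 (map_poly pderiv (f i)) z / eval2 (f i) z * h
                 + eval2 (pderiv (f i)) z / eval2 (f i) z * k)))) (at z)"
      unfolding F_exp by (rule has_derivative_compose[of _ _ z UNIV])
    then show ?thesis
      by (simp add: a_def b_def case_prod_unfold algebra_simps sum.distrib
          sum_distrib_left sum_distrib_right)
  qed
  have invariant: "a (t, x) + (poly A t * x ^ 3 + poly B t * x ^ 2) * b (t, x) = 0"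
    if z: "(t, x) \<in> U" for t x
  proof -
    let ?v = "poly A t * x ^ 3 + poly B t * x ^ 2"
    have "a (t, x) + ?v * b (t, x) =
       (\<Sum>i\<in>I. \<alpha> i * (eval2 (abel_vf A B (f i)) (t, x) / eval2 (f i) (t, x)))"
      unfolding a_def b_def eval2_abel_vf sum_distrib_left
      by (simp add: sum.distrib[symmetric] add_divide_distrib distrib_left mult.left_commute)
    also have "\<dots> = (\<Sum>i\<in>I. \<alpha> i * eval2 (K i) (t, x))"
    proof (rule sum.cong[OF refl])
      fix i assume i: "i \<in> I"
      have "eval2 (f i) (t, x) \<noteq> 0" using expL[OF i z] exp_not_eq_zero by metis
      then show "\<alpha> i * (eval2 (abel_vf A B (f i)) (t, x) / eval2 (f i) (t, x)) =
          \<alpha> i * eval2 (K i) (t, x)"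
        by (simp add: cofactor[OF i])
    qed
    also have "\<dots> = eval2 (\<Sum>i\<in>I. smult [:\<alpha> i:] (K i)) (t, x)"
      by (simp add: eval2_sum)
    finally show ?thesis by (simp add: sum0)
  qed
  have "\<not> F constant_on U"
  proof
    assume "F constant_on U"
    then obtain c where c: "\<And>z. z \<in> U \<Longrightarrow> F z = c" by (auto simp: constant_on_def)
    have "(F has_derivative (\<lambda>v. 0)) (at z\<^sub>0)"
      by (rule has_derivative_transform_within_open[OF has_derivative_const[of c] U(1,3)])
        (simp add: c)
    \<comment> \<open>The direction \<open>(1, 0)\<close> extracts the \<open>t\<close>-derivative
      \<open>F * a\<close>.\<close>
    from fun_cong[OF has_derivative_unique[OF this F'[OF U(3)]], of "(1, 0)"]
    have "F z\<^sub>0 * a z\<^sub>0 = 0" by simp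
    moreover have "F z\<^sub>0 \<noteq> 0" by (simp add: F_exp)
    ultimately show False using deriv_nz by (simp add: a_def)
  qed
  moreover have "\<exists>a b. (F has_derivative (\<lambda>(h, k). a * h + b * k)) (at (t, x)) \<and>
        a + (poly A t * x ^ 3 + poly B t * x ^ 2) * b = 0" if z: "(t, x) \<in> U" for t x
  proof (intro exI conjI)
    show "(F has_derivative (\<lambda>(h, k). F (t, x) * a (t, x) * h + F (t, x) * b (t, x) * k)) (at (t, x))"
      by (rule F'[OF z])
    have "F (t, x) * (a (t, x) + (poly A t * x ^ 3 + poly B t * x ^ 2) * b (t, x)) = 0"
      by (simp add: invariant[OF z])
    then show "F (t, x) * a (t, x) +
        (poly A t * x ^ 3 + poly B t * x ^ 2) * (F (t, x) * b (t, x)) = 0"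
      by (simp add: algebra_simps)
  qed
  ultimately have "first_integral_on A B U F"
    unfolding first_integral_on_def by auto
  \<comment> \<open>The factors of a Darboux first integral are indexed by the numbers below
    \<open>r\<close>, so \<open>I\<close> is enumerated.\<close>
  moreover obtain e where e: "bij_betw e {..<card I} I"
    using ex_bij_betw_nat_finite[OF I] by (auto simp: atLeast0LessThan)
  have eI: "e i \<in> I" if "i < card I" for i using e that by (auto simp: bij_betw_def)
  have "continuous_on U (L i)" if "i \<in> I" for i
    using L'[OF that] by (meson continuous_at_imp_continuous_on has_derivative_continuous)
  then have "(\<forall>i<card I. algebraic_invariant_curve A B (f (e i)) \<and> continuous_on U (L (e i)) \<and>
               (\<forall>z\<in>U. exp (L (e i) z) = eval2 (f (e i)) z)) \<and>
        (\<forall>z\<in>U. F z = (\<Prod>i<card I. exp (\<alpha> (e i) * L (e i) z)))"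
    using nonconst cofactor expL eI
    by (auto simp: algebraic_invariant_curve_def F_def prod.reindex_bij_betw[OF e, symmetric])
  ultimately have "darboux_first_integral_on A B U F"
    unfolding darboux_first_integral_on_def
    by (intro conjI exI[of _ "card I"] exI[of _ "f \<circ> e"] exI[of _ "\<alpha> \<circ> e"] exI[of _ "L \<circ> e"]) simp_all
  then show ?thesis
    using U unfolding has_darboux_first_integral_def by blast
qed

section \<open>Cofactors and degrees of curves linear in \<open>x\<close>\<close>

lemma abel_vf_linear:
  "abel_vf A B [:1, p:] = [:0, pderiv p, B * p, A * p:]"
  "abel_vf A B [:0, 1:] = [:0, B, A:] * [:0, 1:]"
  by (simp_all add: abel_vf_def map_poly_pCons pderiv_pCons)

text \<open>Comparing coefficients of powers of \<open>x\<close> gives \<open>K\<close> the constant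
  term 0, the linear term \<open>p'\<close> and, from the cubic equation, the quadratic term
  \<open>A\<close>. The quadratic equation then reads \<open>B p = A + p p'\<close>.\<close>

lemma abel_invariant_curveD:
  assumes "p \<in> abel_invariant_curves A B"
  shows "degree p > 0" and "p * (B - pderiv p) = A"
    and "abel_vf A B [:1, p:] = [:0, pderiv p, A:] * [:1, p:]"
proof -
  show deg: "degree p > 0" using assms by (simp add: abel_invariant_curves_def)
  obtain K where K: "[:0, pderiv p, B * p, A * p:] = K * [:1, p:]"
    using assms by (auto simp: abel_invariant_curves_def abel_vf_linear)
  have "p \<noteq> 0" using deg by auto
  \<comment> \<open>Degrees are in \<open>x\<close> here: the product has degree at most 3 and
    \<open>[:1, p:]\<close> has degree 1, so \<open>K\<close> has degree at most 2.\<close>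
  have "coeff K 3 = 0"
  proof (cases "K = 0")
    case False
    then have "degree (K * [:1, p:]) = degree K + 1"
      using \<open>p \<noteq> 0\<close> by (subst degree_mult_eq) auto
    moreover have "degree [:0, pderiv p, B * p, A * p:] \<le> 3" by (simp add: degree_pCons_le)
    ultimately show ?thesis by (simp add: K coeff_eq_0)
  qed simp
  moreover have "coeff [:0, pderiv p, B * p, A * p:] (Suc i) = coeff K (Suc i) + p * coeff K i" for i
    by (simp add: K)
  note c = this[of 0] this[of 1] this[of 2]
  moreover have "coeff [:0, pderiv p, B * p, A * p:] 0 = coeff K 0" by (simp add: K)
  ultimately have *: "coeff K 1 = pderiv p" "B * p = coeff K 2 + p * coeff K 1" "A * p = p * coeff K 2"
    by (simp_all add: numeral_eq_Suc)
  then show A: "p * (B - pderiv p) = A" using \<open>p \<noteq> 0\<close> by (simp add: algebra_simps)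
  show "abel_vf A B [:1, p:] = [:0, pderiv p, A:] * [:1, p:]"
    unfolding abel_vf_linear by (simp flip: A add: algebra_simps)
qed

lemma degree_add_degree_invariant_curves:
  assumes p: "p \<in> abel_invariant_curves A B" and r: "r \<in> abel_invariant_curves A B"
    and "p \<noteq> r" and "A \<noteq> 0"
  shows "degree p + degree r = degree A + 1"
proof -
  have eq: "p * r * pderiv (p - r) = A * (p - r)"
  proof -
    have "A * (p - r) = p * (r * (B - pderiv r)) - r * (p * (B - pderiv p))"
      using abel_invariant_curveD(2)[OF p] abel_invariant_curveD(2)[OF r] by (simp add: algebra_simps)
    then show ?thesis by (simp add: pderiv_diff algebra_simps)
  qed
  have nz: "p \<noteq> 0" "r \<noteq> 0" "p - r \<noteq> 0"
    using abel_invariant_curveD(1)[OF p] abel_invariant_curveD(1)[OF r] \<open>p \<noteq> r\<close> by auto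
  \<comment> \<open>As \<open>A * (p - r)\<close> is non-zero, \<open>p - r\<close> is not constant.
    In characteristic 0 its derivative then has degree exactly one less, which yields the term
    \<open>+ 1\<close>.\<close>
  then have "pderiv (p - r) \<noteq> 0" using eq \<open>A \<noteq> 0\<close> by auto
  then have "degree (p - r) > 0" by (auto simp: pderiv_eq_0_iff)
  moreover have "degree p + degree r + degree (pderiv (p - r)) = degree A + degree (p - r)"
    using nz \<open>A \<noteq> 0\<close> \<open>pderiv (p - r) \<noteq> 0\<close> arg_cong[OF eq, of degree] by (simp add: degree_mult_eq)
  ultimately show ?thesis by (simp add: degree_pderiv)
qed

section \<open>Linear dependence by dimension\<close>

text \<open>All \<open>g s\<close> lie in the span of the \<open>m\<close> monomials of degree below
  \<open>m\<close>. Injectivity carries the relation from the image set, of which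
  \<open>V.dependent\<close> speaks, back to the indices.\<close>

lemma polys_linear_dependence:
  fixes g :: "'b \<Rightarrow> 'a::field poly"
  assumes S: "finite S" "card S > m" and inj: "inj_on g S" and deg: "\<And>s. s \<in> S \<Longrightarrow> degree (g s) < m"
  obtains u where "\<exists>s\<in>S. u s \<noteq> 0" "(\<Sum>s\<in>S. smult (u s) (g s)) = 0"
proof -
  interpret V: vector_space "smult :: 'a \<Rightarrow> 'a poly \<Rightarrow> 'a poly"
    by unfold_locales (simp_all add: smult_add_right smult_add_left)
  have "g s \<in> V.span (monom 1 ` {..<m})" if "s \<in> S" for s
  proof -
    have "(\<Sum>i\<le>degree (g s). smult (coeff (g s) i) (monom 1 i)) \<in> V.span (monom 1 ` {..<m})"
      using deg[OF that] by (intro V.span_sum V.span_scale V.span_base) auto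
    then show ?thesis by (simp add: smult_monom poly_as_sum_of_monoms)
  qed
  moreover have "card (monom (1::'a) ` {..<m}) \<le> m"
    using card_image_le[of "{..<m}"] by simp
  ultimately have "V.dependent (g ` S)"
    using V.independent_span_bound[of "monom 1 ` {..<m}" "g ` S"] S card_image[OF inj]
    by (fastforce simp: image_subset_iff)
  then obtain u where "\<exists>v\<in>g ` S. u v \<noteq> 0" "(\<Sum>v\<in>g ` S. smult (u v) v) = 0"
    using V.dependent_finite[of "g ` S"] S by auto
  then show thesis
    using that[of "u \<circ> g"] by (simp add: sum.reindex[OF inj])
qed

section \<open>Non-vanishing of the logarithmic \<open>t\<close>-derivative\<close>

lemma sum_pCons: "(\<Sum>i\<in>I. pCons (a i) (p i)) = pCons (\<Sum>i\<in>I. a i) (\<Sum>i\<in>I. p i)"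
  by (induction I rule: infinite_finite_induct) simp_all

lemma ex_nonroot:
  fixes p :: "'a::field_char_0 poly"
  assumes "p \<noteq> 0"
  obtains z where "poly p z \<noteq> 0"
  using assms poly_all_0_iff_0 by blast

text \<open>
  For \<open>t\<close> outside a finite set, the sum below is a rational function of \<open>x\<close> with a genuine pole at
  \<open>-1 / p\<^sub>0(t)\<close>; \<open>G\<close> is its numerator divided by \<open>x\<close>.
\<close>

lemma ex_log_derivative_nonzero:
  fixes S :: "complex poly set"
  assumes S: "finite S" "\<And>p. p \<in> S \<Longrightarrow> degree p > 0" and u: "p\<^sub>0 \<in> S" "u p\<^sub>0 \<noteq> 0"
  obtains t x where "x \<noteq> 0" "\<And>p. p \<in> S \<Longrightarrow> 1 + x * poly p t \<noteq> 0"
    "(\<Sum>p\<in>S. u p * (x * poly (pderiv p) t / (1 + x * poly p t))) \<noteq> 0"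
proof -
  \<comment> \<open>The first factor makes the pole of the term of \<open>p\<^sub>0\<close> finite,
    the second keeps its residue non-zero, and the product separates it from the poles of the other
    terms.\<close>
  have "p\<^sub>0 * pderiv p\<^sub>0 * (\<Prod>p\<in>S - {p\<^sub>0}. p\<^sub>0 - p) \<noteq> 0"
    using S u by (force simp: pderiv_eq_0_iff)
  then obtain t where "poly (p\<^sub>0 * pderiv p\<^sub>0 * (\<Prod>p\<in>S - {p\<^sub>0}. p\<^sub>0 - p)) t \<noteq> 0"
    by (rule ex_nonroot)
  then have t: "poly p\<^sub>0 t \<noteq> 0" "poly (pderiv p\<^sub>0) t \<noteq> 0" "\<And>p. p \<in> S \<Longrightarrow> p \<noteq> p\<^sub>0 \<Longrightarrow> poly p t \<noteq> poly p\<^sub>0 t"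
    using S by (auto simp: poly_prod) (metis DiffI singletonD)
  define G where "G = (\<Sum>p\<in>S. smult (u p * poly (pderiv p) t) (\<Prod>r\<in>S - {p}. [:1, poly r t:]))"
  \<comment> \<open>For \<open>p \<noteq> p\<^sub>0\<close> the product contains the factor
    \<open>r = p\<^sub>0\<close>, which vanishes at this point.\<close>
  have "poly G (- 1 / poly p\<^sub>0 t) =
      (\<Sum>p\<in>S. if p = p\<^sub>0 then u p\<^sub>0 * poly (pderiv p\<^sub>0) t * (\<Prod>r\<in>S - {p\<^sub>0}. 1 - poly r t / poly p\<^sub>0 t) else 0)"
    unfolding G_def poly_sum poly_smult poly_prod
  proof (intro sum.cong refl)
    fix p assume "p \<in> S"
    show "u p * poly (pderiv p) t * (\<Prod>r\<in>S - {p}. poly [:1, poly r t:] (- 1 / poly p\<^sub>0 t)) =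
      (if p = p\<^sub>0 then u p\<^sub>0 * poly (pderiv p\<^sub>0) t * (\<Prod>r\<in>S - {p\<^sub>0}. 1 - poly r t / poly p\<^sub>0 t) else 0)"
      using S u t by (auto intro!: bexI[of _ p\<^sub>0])
  qed
  also have "\<dots> \<noteq> 0" using S u t by auto
  finally have "G \<noteq> 0" by auto
  then have "[:0, 1:] * G * (\<Prod>r\<in>S. [:1, poly r t:]) \<noteq> 0" using S by auto
  then obtain x where "poly ([:0, 1:] * G * (\<Prod>r\<in>S. [:1, poly r t:])) x \<noteq> 0" by (rule ex_nonroot)
  then have x: "x \<noteq> 0" "poly G x \<noteq> 0" "\<And>p. p \<in> S \<Longrightarrow> 1 + x * poly p t \<noteq> 0"
    using S by (auto simp: poly_prod)
  have "poly G x * x / (\<Prod>r\<in>S. 1 + x * poly r t) =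
      (\<Sum>p\<in>S. u p * (x * poly (pderiv p) t / (1 + x * poly p t)))"
    unfolding G_def poly_sum poly_smult poly_prod sum_distrib_right sum_divide_distrib
  proof (intro sum.cong refl)
    fix p assume p: "p \<in> S"
    have "(\<Prod>r\<in>S - {p}. 1 + x * poly r t) \<noteq> 0" using x(3) S by auto
    moreover have "(\<Prod>r\<in>S. 1 + x * poly r t) = (1 + x * poly p t) * (\<Prod>r\<in>S - {p}. 1 + x * poly r t)"
      using S(1) p by (rule prod.remove)
    ultimately show "u p * poly (pderiv p) t * (\<Prod>r\<in>S - {p}. poly [:1, poly r t:] x) * x /
        (\<Prod>r\<in>S. 1 + x * poly r t) = u p * (x * poly (pderiv p) t / (1 + x * poly p t))"
      using x(3)[OF p] by (simp add: mult_ac)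
  qed
  moreover have "poly G x * x / (\<Prod>r\<in>S. 1 + x * poly r t) \<noteq> 0" using x S by auto
  ultimately show thesis using that[of x t] x by auto
qed

section \<open>Counting the curves and choosing the exponents\<close>

theorem theorem3p3:
  fixes A B :: "complex poly" and n :: nat
  assumes "n = degree A" and "n \<ge> 3"
    and "infinite (abel_invariant_curves A B) \<or>
         real (card (abel_invariant_curves A B)) > (real n + 1) / 2"
  shows "has_darboux_first_integral A B"
proof -
  have "A \<noteq> 0" using assms by auto
  \<comment> \<open>A finite subfamily treats the finite and the infinite case alike.\<close>
  obtain S where S: "S \<subseteq> abel_invariant_curves A B" "finite S" "2 * card S > n + 1"
  proof (cases "finite (abel_invariant_curves A B)")
    case True
    then have "2 * card (abel_invariant_curves A B) > n + 1"
      using assms(3) by simp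
    then show thesis using that True by blast
  next
    case False
    then obtain S where "S \<subseteq> abel_invariant_curves A B" "finite S" "card S = n + 2"
      using infinite_arbitrarily_large by metis
    then show thesis using that by simp
  qed
  note curve = abel_invariant_curveD[OF subsetD[OF S(1)]]
  note degsum = degree_add_degree_invariant_curves[OF subsetD[OF S(1)] subsetD[OF S(1)] _ \<open>A \<noteq> 0\<close>,
      folded assms(1)]
  have deg: "2 * degree p = n + 1" if p: "p \<in> S" for p
  proof -
    \<comment> \<open>Since \<open>n \<ge> 3\<close>, \<open>2 * card S > 4\<close>, so
      \<open>p\<close> has two companions \<open>r\<close> and \<open>s\<close>. The three pairwise
      degree sums all equal \<open>n + 1\<close>, so each degree is half of it.\<close>
    have "card (S - {p}) \<ge> 2" using S p \<open>n \<ge> 3\<close> by simp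
    then obtain r s where "r \<in> S - {p}" "s \<in> S - {p}" "r \<noteq> s"
      by (metis card_le_Suc0_iff_eq finite_Diff S(2) not_less_eq_eq numeral_2_eq_2)
    then show ?thesis
      using degsum[of p r] degsum[of p s] degsum[of r s] p by auto
  qed
  \<comment> \<open>By \<open>deg\<close>, \<open>n\<close> is odd once \<open>S\<close> has an
    element, so the division is exact and the degree in question is
    \<open>n - degree p = degree p - 1\<close>.\<close>
  have deg_q: "degree (B - pderiv p) < (n + 1) div 2" if p: "p \<in> S" for p
  proof -
    have "degree p + degree (B - pderiv p) = n"
      using curve(2)[OF p] \<open>A \<noteq> 0\<close> assms(1) by (metis degree_mult_eq mult_eq_0_iff)
    then show ?thesis using deg[OF p] by simp
  qed
  \<comment> \<open>A common value of \<open>B - p'\<close> is non-zero because its product with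
    either curve is \<open>A\<close>; cancelling it identifies the curves.\<close>
  have inj: "inj_on (\<lambda>p. B - pderiv p) S"
    by (rule inj_onI) (metis curve(2) \<open>A \<noteq> 0\<close> mult_cancel_right mult_eq_0_iff)
  \<comment> \<open>The number of curves enters here: it exceeds the dimension
    \<open>(n + 1) div 2\<close>.\<close>
  obtain u where u: "\<exists>p\<in>S. u p \<noteq> 0" "(\<Sum>p\<in>S. smult (u p) (B - pderiv p)) = 0"
    by (rule polys_linear_dependence[OF S(2) _ inj, of "(n + 1) div 2"]) (use S deg_q in auto)
  obtain p\<^sub>0 where p0: "p\<^sub>0 \<in> S" "u p\<^sub>0 \<noteq> 0" using u(1) by blast
  obtain t x where tx: "x \<noteq> 0" "\<And>p. p \<in> S \<Longrightarrow> 1 + x * poly p t \<noteq> 0"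
    "(\<Sum>p\<in>S. u p * (x * poly (pderiv p) t / (1 + x * poly p t))) \<noteq> 0"
    by (rule ex_log_derivative_nonzero[where u = u, OF S(2) curve(1) p0]) auto
  \<comment> \<open>\<open>None\<close> stands for the curve \<open>x = 0\<close>,
    \<open>Some p\<close> for \<open>1 + p x = 0\<close>.\<close>
  define I where "I = insert None (Some ` S)"
  have I: "finite I" using S by (simp add: I_def)
  have sum_I: "(\<Sum>i\<in>I. h i) = h None + (\<Sum>p\<in>S. h (Some p))" for h :: "_ \<Rightarrow> 'z::comm_monoid_add"
    using S by (simp add: I_def sum.reindex)
  define f :: "complex poly option \<Rightarrow> complex poly poly"
    where "f = case_option [:0, 1:] (\<lambda>p. [:1, p:])"
  define K :: "complex poly option \<Rightarrow> complex poly poly"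
    where "K = case_option [:0, B, A:] (\<lambda>p. [:0, pderiv p, A:])"
  \<comment> \<open>With this exponent of \<open>x\<close> the terms \<open>A x^2\<close> of the
    cofactors cancel; the coefficient of \<open>x\<close> that remains is minus the relation found
    for \<open>u\<close>.\<close>
  define \<alpha> where "\<alpha> = case_option (- (\<Sum>p\<in>S. u p)) u"
  have "(\<Sum>i\<in>I. smult [:\<alpha> i:] (K i)) = [:0, - (\<Sum>p\<in>S. smult (u p) (B - pderiv p)):]"
    by (simp add: sum_I \<alpha>_def K_def sum_pCons smult_sum smult_diff_right sum_subtractf)
  then have sum0: "(\<Sum>i\<in>I. smult [:\<alpha> i:] (K i)) = 0" by (simp add: u(2))
  show ?thesis
  proof (rule has_darboux_first_integralI[OF I _ _ sum0, where z\<^sub>0 = "(t, x)"])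
    fix i assume i: "i \<in> I"
    show "\<nexists>c. f i = [:[:c:]:]"
      using i curve(1) by (fastforce simp: f_def I_def)
    show "abel_vf A B (f i) = K i * f i"
      using i curve(3) by (auto simp: f_def K_def I_def abel_vf_linear(2))
    show "eval2 (f i) (t, x) \<noteq> 0"
      using i tx by (auto simp: f_def I_def)
  next
    \<comment> \<open>The curve \<open>x = 0\<close> contributes nothing, as the
      \<open>t\<close>-derivative of \<open>x\<close> is 0.\<close>
    show "(\<Sum>i\<in>I. \<alpha> i * (eval2 (map_poly pderiv (f i)) (t, x) / eval2 (f i) (t, x))) \<noteq> 0"
      using tx(3) by (simp add: sum_I f_def \<alpha>_def map_poly_pCons)
  qed
qed

end
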